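(* Let $N = \{1,2,\ldots,n\}$ and let $\{N_1, N_2\}$ be a partition of $N$. The set of intervals $$\{[\bot,\bot]\} \cup \{[\alpha_1 \vee \alpha_2,\ \alpha_1 \otimes \alpha_2] \;:\; \alpha_1 \in \mathcal{A}_{N_1},\ \alpha_2 \in \mathcal{A}_{N_2},\ \alpha_1 \neq \bot,\ \alpha_2 \neq \bot\}$$ is a partition of $\mathcal{A}_N$.
   Context: For a finite set $N$, $\mathcal{A}_N$ denotes the set of antichains in $N$: sets $\alpha \subseteq 2^N$ of subsets of $N$ such that no two distinct members of $\alpha$ are in a subset/superset relationship; $\bot=\{\}$ is the empty antichain (distinct from $\{\emptyset\}$). Order: $\alpha \le \beta$ iff for every $A \in \alpha$ there is $B \in \beta$ with $A \subseteq B$. Join: $\alpha\vee\beta=\max(\alpha\cup\beta)$, where $\max$ of a set of sets keeps only the inclusion-maximal sets. Intervals in $\mathcal{A}_N$: $[\alpha,\beta]=\{\chi \in \mathcal{A}_N : \alpha \le \chi \le \beta\}$. Antichains in $N_1$ or $N_2$ are regarded as antichains in $N$. For antichains $\alpha,\beta$ with $(\bigcup_{X\in\alpha}X)\cap(\bigcup_{X\in\beta}X)=\emptyset$, the direct product is $\alpha\otimes\beta=\{A\cup B : A\in\alpha, B\in\beta\}$. *)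

theory Defs
  imports Main "HOL-Library.Disjoint_Sets"
begin

definition antichains :: "'a set \<Rightarrow> 'a set set set" where
  "antichains N = {\<alpha>. \<alpha> \<subseteq> Pow N \<and> (\<forall>A\<in>\<alpha>. \<forall>B\<in>\<alpha>. A \<noteq> B \<longrightarrow> \<not> A \<subseteq> B)}"

definition ac_le :: "'a set set \<Rightarrow> 'a set set \<Rightarrow> bool"  (infix "\<sqsubseteq>" 50) where
  "\<alpha> \<sqsubseteq> \<beta> \<longleftrightarrow> (\<forall>A\<in>\<alpha>. \<exists>B\<in>\<beta>. A \<subseteq> B)"

definition maximal_sets :: "'a set set \<Rightarrow> 'a set set" where
  "maximal_sets S = {A \<in> S. \<not> (\<exists>B\<in>S. A \<subset> B)}"

definition ac_join :: "'a set set \<Rightarrow> 'a set set \<Rightarrow> 'a set set"  (infixl "\<squnion>" 65) where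
  "\<alpha> \<squnion> \<beta> = maximal_sets (\<alpha> \<union> \<beta>)"

(* The direct product is meant only for antichains with disjoint supports
   (\<Union>\<alpha> \<inter> \<Union>\<beta> = {}); the definition is total, and outside that domain its value
   need not be an antichain. *)
definition ac_prod :: "'a set set \<Rightarrow> 'a set set \<Rightarrow> 'a set set"  (infixl "\<otimes>" 70) where
  "\<alpha> \<otimes> \<beta> = {A \<union> B | A B. A \<in> \<alpha> \<and> B \<in> \<beta>}"

definition ac_interval :: "'a set \<Rightarrow> 'a set set \<Rightarrow> 'a set set \<Rightarrow> 'a set set set" where
  "ac_interval N \<alpha> \<beta> = {\<chi> \<in> antichains N. \<alpha> \<sqsubseteq> \<chi> \<and> \<chi> \<sqsubseteq> \<beta>}"

end

theory Submission
  imports Defs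
begin

text \<open>
  A nonempty antichain \<open>\<chi>\<close> in \<open>N\<close> lies in \<open>[\<alpha>\<^sub>1 \<or> \<alpha>\<^sub>2, \<alpha>\<^sub>1 \<otimes> \<alpha>\<^sub>2]\<close> exactly when each \<open>\<alpha>\<^sub>i\<close> is the
  antichain of maximal elements of the trace \<open>{C \<inter> N\<^sub>i : C \<in> \<chi>}\<close>: the lower bound says that \<open>\<alpha>\<^sub>i\<close> is
  below the trace, the upper bound that the trace is below \<open>\<alpha>\<^sub>i\<close>, and \<open>\<le>\<close> is antisymmetric on
  antichains. Hence \<open>\<chi>\<close> determines the interval containing it.
\<close>

lemma ac_le_trans: "\<alpha> \<sqsubseteq> \<beta> \<Longrightarrow> \<beta> \<sqsubseteq> \<gamma> \<Longrightarrow> \<alpha> \<sqsubseteq> \<gamma>"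
  unfolding ac_le_def by (meson subset_trans)

text \<open>Going up from \<open>A\<close> to some \<open>B\<close> in the other antichain and back
  to some \<open>C\<close> gives A \<subseteq> B \<subseteq> C; incomparability inside the first
  antichain forces A = C, so \<open>B\<close> is \<open>A\<close> itself.\<close>

lemma ac_le_antisym:
  assumes "\<alpha> \<in> antichains M" "\<beta> \<in> antichains M" "\<alpha> \<sqsubseteq> \<beta>" "\<beta> \<sqsubseteq> \<alpha>"
  shows "\<alpha> = \<beta>"
proof -
  have "\<gamma> \<subseteq> \<delta>" if ac: "\<gamma> \<in> antichains M" and le: "\<gamma> \<sqsubseteq> \<delta>" "\<delta> \<sqsubseteq> \<gamma>" for \<gamma> \<delta>
  proof
    fix A assume "A \<in> \<gamma>"
    then obtain B C where "B \<in> \<delta>" "A \<subseteq> B" "C \<in> \<gamma>" "B \<subseteq> C"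
      using le unfolding ac_le_def by meson
    moreover have "A = C"
      using ac \<open>A \<in> \<gamma>\<close> calculation unfolding antichains_def by blast
    ultimately show "A \<in> \<delta>" by (metis subset_antisym)
  qed
  then show ?thesis using assms by blast
qed

lemma finite_antichain: "finite M \<Longrightarrow> \<alpha> \<in> antichains M \<Longrightarrow> finite \<alpha>"
  unfolding antichains_def by (auto intro: finite_subset)

lemma antichains_mono: "M \<subseteq> N \<Longrightarrow> antichains M \<subseteq> antichains N"
  unfolding antichains_def by blast

lemma maximal_sets_antichain: "S \<subseteq> Pow M \<Longrightarrow> maximal_sets S \<in> antichains M"
  unfolding maximal_sets_def antichains_def by blast

lemma maximal_sets_le: "maximal_sets S \<sqsubseteq> S"
  unfolding maximal_sets_def ac_le_def by blast

text \<open>Finiteness rules out endless ascending chains, so every member sits below a maximal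
  one.\<close>

lemma le_maximal_sets:
  assumes "finite S"
  shows "S \<sqsubseteq> maximal_sets S"
  unfolding ac_le_def
proof
  fix A assume "A \<in> S"
  then obtain B where "B \<in> S" "A \<subseteq> B" "\<forall>C\<in>S. B \<subseteq> C \<longrightarrow> C = B"
    using finite_has_maximal2[OF assms] by metis
  then show "\<exists>B\<in>maximal_sets S. A \<subseteq> B"
    unfolding maximal_sets_def by blast
qed

text \<open>Union and join are each below the other, so the join may be replaced by the union, where
  the condition splits member by member.\<close>

lemma ac_join_le_iff:
  assumes "finite \<alpha>" "finite \<beta>"
  shows "\<alpha> \<squnion> \<beta> \<sqsubseteq> \<chi> \<longleftrightarrow> \<alpha> \<sqsubseteq> \<chi> \<and> \<beta> \<sqsubseteq> \<chi>"
proof -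
  have "\<alpha> \<squnion> \<beta> \<sqsubseteq> \<chi> \<longleftrightarrow> \<alpha> \<union> \<beta> \<sqsubseteq> \<chi>"
    unfolding ac_join_def
    using ac_le_trans le_maximal_sets maximal_sets_le assms by (metis finite_UnI)
  then show ?thesis unfolding ac_le_def by blast
qed

lemma ac_le_prod_left: "\<beta> \<noteq> {} \<Longrightarrow> \<alpha> \<sqsubseteq> \<alpha> \<otimes> \<beta>"
  unfolding ac_le_def ac_prod_def by blast

lemma ac_prod_commute: "\<alpha> \<otimes> \<beta> = \<beta> \<otimes> \<alpha>"
  unfolding ac_prod_def by blast

text \<open>This projects an upper bound to one block: in A \<subseteq> C \<union> D the part
  \<open>D\<close> lies in M' and cannot meet \<open>A\<close>, so \<open>C\<close> alone covers
  \<open>A\<close>.\<close>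

lemma ac_le_of_le_prod:
  assumes "\<alpha> \<subseteq> Pow M" "\<delta> \<subseteq> Pow M'" "M \<inter> M' = {}" "\<alpha> \<sqsubseteq> \<gamma> \<otimes> \<delta>"
  shows "\<alpha> \<sqsubseteq> \<gamma>"
  unfolding ac_le_def
proof
  fix A assume "A \<in> \<alpha>"
  then obtain C D where "C \<in> \<gamma>" "D \<in> \<delta>" "A \<subseteq> C \<union> D"
    using assms(4) unfolding ac_le_def ac_prod_def by blast
  then have "A \<subseteq> C" using assms(1-3) \<open>A \<in> \<alpha>\<close> by blast
  then show "\<exists>C\<in>\<gamma>. A \<subseteq> C" using \<open>C \<in> \<gamma>\<close> by blast
qed

lemma ac_interval_bot: "ac_interval N {} {} = {{}}"
  unfolding ac_interval_def antichains_def ac_le_def by auto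

lemma mem_ac_interval_join_prod_iff:
  assumes "finite M1" "finite M2" "\<alpha>1 \<in> antichains M1" "\<alpha>2 \<in> antichains M2"
  shows "\<chi> \<in> ac_interval N (\<alpha>1 \<squnion> \<alpha>2) (\<alpha>1 \<otimes> \<alpha>2) \<longleftrightarrow>
    \<chi> \<in> antichains N \<and> \<alpha>1 \<sqsubseteq> \<chi> \<and> \<alpha>2 \<sqsubseteq> \<chi> \<and> \<chi> \<sqsubseteq> \<alpha>1 \<otimes> \<alpha>2"
  using assms by (auto simp: ac_interval_def ac_join_le_iff finite_antichain)

text \<open>The lower endpoint is itself a member. It lies below the product because each factor can
  be enlarged by a member of the other, which is where both factors must differ from the
  bottom.\<close>

lemma ac_interval_join_prod_nonempty:
  assumes "finite M1" "finite M2" "M1 \<subseteq> N" "M2 \<subseteq> N"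
    and "\<alpha>1 \<in> antichains M1" "\<alpha>2 \<in> antichains M2" "\<alpha>1 \<noteq> {}" "\<alpha>2 \<noteq> {}"
  shows "ac_interval N (\<alpha>1 \<squnion> \<alpha>2) (\<alpha>1 \<otimes> \<alpha>2) \<noteq> {}"
proof -
  have fin: "finite \<alpha>1" "finite \<alpha>2" using assms finite_antichain by auto
  have "\<alpha>1 \<squnion> \<alpha>2 \<in> antichains N"
    unfolding ac_join_def using antichains_mono[OF assms(3)] antichains_mono[OF assms(4)] assms(5,6)
    by (intro maximal_sets_antichain) (simp add: antichains_def subset_iff)
  moreover have "\<alpha>1 \<squnion> \<alpha>2 \<sqsubseteq> \<alpha>1 \<otimes> \<alpha>2"
    using ac_le_prod_left[OF assms(7), of \<alpha>2] ac_le_prod_left[OF assms(8), of \<alpha>1]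
    by (simp add: ac_join_le_iff[OF fin] ac_prod_commute)
  moreover have "\<alpha>1 \<squnion> \<alpha>2 \<sqsubseteq> \<alpha>1 \<squnion> \<alpha>2" unfolding ac_le_def by blast
  ultimately show ?thesis unfolding ac_interval_def by blast
qed

text \<open>Passing through \<chi> puts each factor of one interval below the product of the other,
  hence below the matching factor. Exchanging the two intervals gives the reverse, and antisymmetry
  finishes.\<close>

lemma ac_interval_join_prod_unique:
  assumes "finite M1" "finite M2" "M1 \<inter> M2 = {}"
    and ac: "\<alpha>1 \<in> antichains M1" "\<alpha>2 \<in> antichains M2" "\<beta>1 \<in> antichains M1" "\<beta>2 \<in> antichains M2"
    and "\<chi> \<in> ac_interval N (\<alpha>1 \<squnion> \<alpha>2) (\<alpha>1 \<otimes> \<alpha>2)" "\<chi> \<in> ac_interval N (\<beta>1 \<squnion> \<beta>2) (\<beta>1 \<otimes> \<beta>2)"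
  shows "\<alpha>1 = \<beta>1 \<and> \<alpha>2 = \<beta>2"
proof -
  have le: "\<gamma>1 \<sqsubseteq> \<delta>1 \<and> \<gamma>2 \<sqsubseteq> \<delta>2"
    if "\<gamma>1 \<in> antichains M1" "\<gamma>2 \<in> antichains M2" "\<delta>1 \<in> antichains M1" "\<delta>2 \<in> antichains M2"
      "\<gamma>1 \<sqsubseteq> \<chi>" "\<gamma>2 \<sqsubseteq> \<chi>" "\<chi> \<sqsubseteq> \<delta>1 \<otimes> \<delta>2" for \<gamma>1 \<gamma>2 \<delta>1 \<delta>2
  proof
    have sub: "\<gamma>1 \<subseteq> Pow M1" "\<gamma>2 \<subseteq> Pow M2" "\<delta>1 \<subseteq> Pow M1" "\<delta>2 \<subseteq> Pow M2"
      using that unfolding antichains_def by auto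
    show "\<gamma>1 \<sqsubseteq> \<delta>1"
      using ac_le_of_le_prod sub assms(3) ac_le_trans that by metis
    show "\<gamma>2 \<sqsubseteq> \<delta>2"
      \<comment> \<open>Commuting the product turns the second block into the first one of the
        projection lemma.\<close>
      using ac_le_of_le_prod[OF sub(2,3)] assms(3) ac_le_trans that ac_prod_commute
      by (metis inf_commute)
  qed
  have "\<alpha>1 \<sqsubseteq> \<chi>" "\<alpha>2 \<sqsubseteq> \<chi>" "\<chi> \<sqsubseteq> \<alpha>1 \<otimes> \<alpha>2" "\<beta>1 \<sqsubseteq> \<chi>" "\<beta>2 \<sqsubseteq> \<chi>" "\<chi> \<sqsubseteq> \<beta>1 \<otimes> \<beta>2"
    using assms(8,9)
    unfolding mem_ac_interval_join_prod_iff[OF assms(1,2) ac(1,2)]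
      mem_ac_interval_join_prod_iff[OF assms(1,2) ac(3,4)]
    by blast+
  then show ?thesis using le ac ac_le_antisym by meson
qed

text \<open>Existence: each \<open>C\<close> in \<chi> is the union of its two traces, and each
  trace extends to a maximal one, so \<open>C\<close> lies in a member of the product.\<close>

lemma mem_ac_interval_maximal_traces:
  assumes "finite N" "N = M1 \<union> M2" "\<chi> \<in> antichains N"
  defines "\<alpha>1 \<equiv> maximal_sets ((\<lambda>C. C \<inter> M1) ` \<chi>)"
    and "\<alpha>2 \<equiv> maximal_sets ((\<lambda>C. C \<inter> M2) ` \<chi>)"
  shows "\<alpha>1 \<in> antichains M1" "\<alpha>2 \<in> antichains M2"
    and "\<chi> \<in> ac_interval N (\<alpha>1 \<squnion> \<alpha>2) (\<alpha>1 \<otimes> \<alpha>2)"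
proof -
  have fin: "finite \<chi>" using assms finite_antichain by blast
  show ac: "\<alpha>1 \<in> antichains M1" "\<alpha>2 \<in> antichains M2"
    unfolding \<alpha>1_def \<alpha>2_def by (auto intro!: maximal_sets_antichain)
  have trace: "(\<lambda>C. C \<inter> M) ` \<chi> \<sqsubseteq> \<chi>" for M unfolding ac_le_def by blast
  have "\<alpha>1 \<sqsubseteq> \<chi>" "\<alpha>2 \<sqsubseteq> \<chi>"
    unfolding \<alpha>1_def \<alpha>2_def by (rule ac_le_trans[OF maximal_sets_le trace])+
  moreover have "\<chi> \<sqsubseteq> \<alpha>1 \<otimes> \<alpha>2"
    unfolding ac_le_def
  proof
    fix C assume "C \<in> \<chi>"
    have "(\<lambda>C. C \<inter> M1) ` \<chi> \<sqsubseteq> \<alpha>1" "(\<lambda>C. C \<inter> M2) ` \<chi> \<sqsubseteq> \<alpha>2"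
      unfolding \<alpha>1_def \<alpha>2_def using fin by (auto intro!: le_maximal_sets)
    then obtain A B where AB: "A \<in> \<alpha>1" "C \<inter> M1 \<subseteq> A" "B \<in> \<alpha>2" "C \<inter> M2 \<subseteq> B"
      using \<open>C \<in> \<chi>\<close> unfolding ac_le_def by blast
    moreover have "C \<subseteq> M1 \<union> M2"
      using assms(2,3) \<open>C \<in> \<chi>\<close> unfolding antichains_def by blast
    ultimately have "C \<subseteq> A \<union> B" by blast
    then show "\<exists>D\<in>\<alpha>1 \<otimes> \<alpha>2. C \<subseteq> D" using AB unfolding ac_prod_def by blast
  qed
  ultimately show "\<chi> \<in> ac_interval N (\<alpha>1 \<squnion> \<alpha>2) (\<alpha>1 \<otimes> \<alpha>2)"
    using mem_ac_interval_join_prod_iff[OF _ _ ac] assms(1-3) by auto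
qed

theorem theorem5p4:
  fixes n :: nat and N N1 N2 :: "nat set"
  assumes "N = {1..n}"
    and "partition_on N {N1, N2}"
    and "N1 \<noteq> N2"
  shows "partition_on (antichains N)
    ({ac_interval N {} {}} \<union>
     {ac_interval N (\<alpha>1 \<squnion> \<alpha>2) (\<alpha>1 \<otimes> \<alpha>2) | \<alpha>1 \<alpha>2.
        \<alpha>1 \<in> antichains N1 \<and> \<alpha>2 \<in> antichains N2 \<and> \<alpha>1 \<noteq> {} \<and> \<alpha>2 \<noteq> {}})"
    (is "partition_on _ ({_} \<union> ?P)")
proof -
  \<comment> \<open>\<open>disjoint\<close> constrains only distinct members of a set, and {N1, N2}
    collapses when the blocks coincide; N1 \<noteq> N2 is what yields disjointness.\<close>
  have N: "N = N1 \<union> N2" and disj: "N1 \<inter> N2 = {}"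
    using assms(2,3) by (auto simp: partition_on_def disjoint_def)
  have finN: "finite N" using assms(1) by simp
  then have fin: "finite N1" "finite N2" unfolding N by simp_all
  \<comment> \<open>A nonempty \<alpha>1 is never below the empty antichain, so the bottom belongs
    to its own interval only.\<close>
  have bot: "{} \<notin> p" if p: "p \<in> ?P" for p
  proof
    assume "{} \<in> p"
    obtain \<alpha>1 \<alpha>2 where ac: "\<alpha>1 \<in> antichains N1" "\<alpha>2 \<in> antichains N2" and "\<alpha>1 \<noteq> {}"
      and p_eq: "p = ac_interval N (\<alpha>1 \<squnion> \<alpha>2) (\<alpha>1 \<otimes> \<alpha>2)"
      using p by blast
    have "\<alpha>1 \<sqsubseteq> {}"
      using \<open>{} \<in> p\<close> unfolding p_eq mem_ac_interval_join_prod_iff[OF fin ac] by simp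
    then show False using \<open>\<alpha>1 \<noteq> {}\<close> by (auto simp: ac_le_def)
  qed
  have cover: "\<exists>p\<in>?P. \<chi> \<in> p" if \<chi>: "\<chi> \<in> antichains N" "\<chi> \<noteq> {}" for \<chi>
  proof -
    \<comment> \<open>A trace may be the empty set; the result is then possibly {{}}, which still
      differs from the bottom {}.\<close>
    have nonempty: "maximal_sets ((\<lambda>C. C \<inter> M) ` \<chi>) \<noteq> {}" for M
      using le_maximal_sets[of "(\<lambda>C. C \<inter> M) ` \<chi>"] finite_antichain[OF finN \<chi>(1)] \<chi>(2)
      by (auto simp: ac_le_def)
    note traces = mem_ac_interval_maximal_traces[OF finN N \<chi>(1)]
    show ?thesis
      \<comment> \<open>Resolving with \<open>traces(3)\<close> first fixes the interval; its
        membership in \<open>?P\<close> is checked afterwards.\<close>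
      by (rule bexI, rule traces(3), rule CollectI, intro exI conjI, rule refl)
        (simp_all only: traces(1,2) nonempty not_False_eq_True)
  qed
  have unique: "p = q" if pq: "p \<in> ?P" "q \<in> ?P" and \<chi>: "\<chi> \<in> p" "\<chi> \<in> q" for p q \<chi>
  proof -
    obtain \<alpha>1 \<alpha>2 \<beta>1 \<beta>2 where
      ac: "\<alpha>1 \<in> antichains N1" "\<alpha>2 \<in> antichains N2" "\<beta>1 \<in> antichains N1" "\<beta>2 \<in> antichains N2"
      and p: "p = ac_interval N (\<alpha>1 \<squnion> \<alpha>2) (\<alpha>1 \<otimes> \<alpha>2)"
      and q: "q = ac_interval N (\<beta>1 \<squnion> \<beta>2) (\<beta>1 \<otimes> \<beta>2)"
      using pq by blast
    show ?thesis
      using ac_interval_join_prod_unique[OF fin disj ac \<chi>[unfolded p q]] by (simp add: p q)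
  qed
  show ?thesis
    unfolding ac_interval_bot
  proof (rule partition_onI)
    show "\<Union> ({{{}}} \<union> ?P) = antichains N"
    proof
      show "\<Union> ({{{}}} \<union> ?P) \<subseteq> antichains N"
        by (auto simp: ac_interval_def antichains_def)
      show "antichains N \<subseteq> \<Union> ({{{}}} \<union> ?P)"
        using cover by blast
    qed
    show "{} \<notin> {{{}}} \<union> ?P"
    proof
      assume "{} \<in> {{{}}} \<union> ?P"
      then have "{} \<in> ?P" by simp
      then obtain \<alpha>1 \<alpha>2 where
        ac: "\<alpha>1 \<in> antichains N1" "\<alpha>2 \<in> antichains N2" "\<alpha>1 \<noteq> {}" "\<alpha>2 \<noteq> {}"
        and empty: "{} = ac_interval N (\<alpha>1 \<squnion> \<alpha>2) (\<alpha>1 \<otimes> \<alpha>2)"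
        by blast
      show False
        using ac_interval_join_prod_nonempty[OF fin _ _ ac, of N] empty[symmetric] unfolding N by simp
    qed
    show "disjnt p q" if pq: "p \<in> {{{}}} \<union> ?P" "q \<in> {{{}}} \<union> ?P" "p \<noteq> q" for p q
    proof -
      consider "p = {{}}" "q \<in> ?P" | "p \<in> ?P" "q = {{}}" | "p \<in> ?P" "q \<in> ?P"
        using pq by blast
      then show ?thesis
      proof cases
        case 1
        show ?thesis using bot[OF 1(2)] by (simp add: 1(1) disjnt_def)
      next
        case 2
        show ?thesis using bot[OF 2(1)] by (simp add: 2(2) disjnt_def)
      next
        case 3
        \<comment> \<open>Contrapositive: a common antichain would force p = q.\<close>
        show ?thesis unfolding disjnt_iff using unique[OF 3] \<open>p \<noteq> q\<close> by iprover
      qed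
    qed
  qed
qed

end
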